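(* Let $(\mathcal{P},+,\times,\preccurlyeq)$ be the partially ordered semiring of propositions, with additive identity $\top$ and multiplicative identity $\bot$, where $\top\preccurlyeq p\preccurlyeq\bot$ for all $p\in\mathcal{P}$. Let $p,q,r,s\in\mathcal{P}$. If $p\preccurlyeq q$ and $r\preccurlyeq s$, then (i) $p+r\preccurlyeq q+s$, and (ii) $p\times r\preccurlyeq q\times s$.
   Context: $\mathcal{P}$ is the set of propositions of a Boolean propositional algebra (a Boolean algebra with operations $\wedge,\vee,\neg$). Write $p+q:=p\wedge q$ and $p\times q:=p\vee q$. The additive identity is $\top$ (the always-true proposition) and the multiplicative identity is $\bot$ (the always-false proposition). With these, $(\mathcal{P},+,\times)$ is a commutative semiring with zero $\top$ and one $\bot$. The partially ordered semiring $(\mathcal{P},+,\times,\preccurlyeq)$ is this semiring together with a partial order $\preccurlyeq$ on $\mathcal{P}$ such that for all $p,q,r\in\mathcal{P}$: $p\preccurlyeq q$ implies $p+r\preccurlyeq q+r$ (monotony law of addition), and $p\preccurlyeq q$ implies $p\times r\preccurlyeq q\times r$ (monotony law of multiplication). It is also assumed that $\top\preccurlyeq p$ and $p\preccurlyeq\bot$ for all $p\in\mathcal{P}$. *)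

theory Defs
  imports Main
begin

locale commutative_semiring =
  fixes plus :: "'a \<Rightarrow> 'a \<Rightarrow> 'a" (infixl \<open>\<oplus>\<close> 65)
    and times :: "'a \<Rightarrow> 'a \<Rightarrow> 'a" (infixl \<open>\<otimes>\<close> 70)
    and zero :: 'a (\<open>\<zero>\<close>)
    and one :: 'a (\<open>\<one>\<close>)
  assumes plus_monoid: "comm_monoid (\<oplus>) \<zero>"
    and times_monoid: "comm_monoid (\<otimes>) \<one>"
    and distrib: "(p \<oplus> q) \<otimes> r = (p \<otimes> r) \<oplus> (q \<otimes> r)"
    and zero_times: "\<zero> \<otimes> p = \<zero>"

locale partially_ordered_semiring = commutative_semiring +
  fixes le :: "'a \<Rightarrow> 'a \<Rightarrow> bool" (infix \<open>\<preceq>\<close> 50)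
  assumes le_refl: "reflp (\<preceq>)"
    and le_antisym: "antisymp (\<preceq>)"
    and le_trans: "transp (\<preceq>)"
    and plus_monotony: "p \<preceq> q \<Longrightarrow> p \<oplus> r \<preceq> q \<oplus> r"
    and times_monotony: "p \<preceq> q \<Longrightarrow> p \<otimes> r \<preceq> q \<otimes> r"

text \<open>
  Propositions are the elements of an arbitrary Boolean algebra. Beware of the reversal:
  addition is conjunction, multiplication is disjunction, the additive identity is \<open>\<top>\<close>
  and the multiplicative identity is \<open>\<bottom>\<close>.
\<close>

abbreviation prop_plus :: "'a::boolean_algebra \<Rightarrow> 'a \<Rightarrow> 'a" (infixl \<open>+\<^sub>P\<close> 65)
  where "p +\<^sub>P q \<equiv> inf p q"

abbreviation prop_times :: "'a::boolean_algebra \<Rightarrow> 'a \<Rightarrow> 'a" (infixl \<open>\<times>\<^sub>P\<close> 70)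
  where "p \<times>\<^sub>P q \<equiv> sup p q"

lemma commutative_semiring_prop:
  "commutative_semiring (+\<^sub>P) (\<times>\<^sub>P) top (bot :: 'a::boolean_algebra)"
proof
qed (simp_all add: ac_simps sup_inf_distrib1)

text \<open>
  The order \<open>le\<close> is a parameter, independent of the lattice order \<open>\<le>\<close> of the type class.
  The semiring laws hold automatically by \<open>commutative_semiring_prop\<close>.
\<close>

locale partially_ordered_prop_semiring =
  partially_ordered_semiring "(+\<^sub>P)" "(\<times>\<^sub>P)" top bot le
  for le :: "'a::boolean_algebra \<Rightarrow> 'a \<Rightarrow> bool" (infix \<open>\<preceq>\<close> 50) +
  assumes top_le: "top \<preceq> p"
    and le_bot: "p \<preceq> bot"

lemma partially_ordered_prop_semiring_ge:
  "partially_ordered_prop_semiring (\<lambda>p q :: 'a::boolean_algebra. q \<le> p)"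
  by (intro partially_ordered_prop_semiring.intro partially_ordered_semiring.intro
      commutative_semiring_prop partially_ordered_semiring_axioms.intro
      partially_ordered_prop_semiring_axioms.intro)
    (auto intro!: reflpI antisympI transpI intro: le_infI1 le_supI1)

end

theory Submission
  imports Defs
begin

text \<open>Replace one operand at a time: \<open>q +\<^sub>P r\<close> and
  \<open>q \<times>\<^sub>P r\<close> serve as middle terms. For each operation, one use of its
  monotony law trades p for q, another trades r for s, and transitivity of \<open>le\<close> joins
  the two.\<close>

theorem theorem3p4:
  fixes le :: "'a::boolean_algebra \<Rightarrow> 'a \<Rightarrow> bool" (infix \<open>\<preceq>\<close> 50)
    and p q r s :: 'a
  assumes "partially_ordered_prop_semiring (\<preceq>)"
    and "p \<preceq> q"
    and "r \<preceq> s"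
  shows "p +\<^sub>P r \<preceq> q +\<^sub>P s \<and> p \<times>\<^sub>P r \<preceq> q \<times>\<^sub>P s"
proof -
  interpret partially_ordered_prop_semiring "(\<preceq>)"
    by (fact assms(1))
  have "p +\<^sub>P r \<preceq> q +\<^sub>P r"
    using assms(2) by (rule plus_monotony)
  \<comment> \<open>The monotony laws vary only the left operand; commutativity carries them over to
    the right one.\<close>
  moreover have "q +\<^sub>P r \<preceq> q +\<^sub>P s"
    using plus_monotony[OF assms(3), of q] by (simp only: inf_commute)
  moreover have "p \<times>\<^sub>P r \<preceq> q \<times>\<^sub>P r"
    using assms(2) by (rule times_monotony)
  moreover have "q \<times>\<^sub>P r \<preceq> q \<times>\<^sub>P s"
    using times_monotony[OF assms(3), of q] by (simp only: sup_commute)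
  ultimately show ?thesis
    by (blast intro: transpD[OF le_trans])
qed

end
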